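(* For all $n\ge 1$, $\operatorname{odim}(\mathcal S_n)=n$, where $\mathcal S_n\subseteq 2^{[n+1]}$ is the code consisting of $[n]$, all singletons $\{i\}$ for $i\in[n+1]$, all pairs $\{i,n+1\}$ for $1\le i\le n$, and $\emptyset$.
   Context: For $\mathcal U=\{U_1,\dots,U_N\}$ subsets of $\mathbb R^d$, $U_\sigma=\bigcap_{i\in\sigma}U_i$ ($U_\emptyset=\mathbb R^d$) and $\operatorname{code}(\mathcal U)=\{\sigma\subseteq[N] : U_\sigma\setminus\bigcup_{j\notin\sigma}U_j\neq\emptyset\}$. $\operatorname{odim}(\mathcal C)$ is the least $d$ such that $\mathcal C=\operatorname{code}(\mathcal U)$ for some collection of (possibly empty) convex open sets in $\mathbb R^d$, or $\infty$ if none exists. *)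

theory Defs
  imports "HOL-Analysis.Analysis" "HOL-Library.Extended_Nat"
begin

text \<open>
  The dimension \<open>d\<close> is quantified over in the definition of the open embedding dimension and may
  be \<open>0\<close>, so \<open>\<real>\<^sup>d\<close> cannot be a type here. It is the library's topological space
  \<^term>\<open>Euclidean_space d\<close>, whose points are the functions \<open>x :: nat \<Rightarrow> real\<close> with
  \<open>x i = 0\<close> for all \<open>i \<ge> d\<close>, under the product topology, that is, the usual topology on the
  coordinates \<open>0, \<dots>, d - 1\<close>.
\<close>

text \<open>The type \<open>nat \<Rightarrow> real\<close> is not an instance of \<^class>\<open>real_vector\<close>, so
  \<^const>\<open>convex\<close> is not available on it.\<close>

definition fun_convex :: "(nat \<Rightarrow> real) set \<Rightarrow> bool" where
  "fun_convex S \<longleftrightarrow>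
     (\<forall>x\<in>S. \<forall>y\<in>S. \<forall>u\<ge>0. \<forall>v\<ge>0. u + v = 1 \<longrightarrow> (\<lambda>i. u * x i + v * y i) \<in> S)"

text \<open>The intersection with the whole space matters only for \<open>\<sigma> = {}\<close>, where it gives
  \<open>U\<^sub>\<emptyset> = \<real>\<^sup>d\<close>.\<close>

definition cell :: "nat \<Rightarrow> (nat \<Rightarrow> (nat \<Rightarrow> real) set) \<Rightarrow> nat set \<Rightarrow> (nat \<Rightarrow> real) set" where
  "cell d U \<sigma> = topspace (Euclidean_space d) \<inter> (\<Inter>i\<in>\<sigma>. U i)"

definition code_of :: "nat \<Rightarrow> nat \<Rightarrow> (nat \<Rightarrow> (nat \<Rightarrow> real) set) \<Rightarrow> nat set set" where
  "code_of d N U = {\<sigma>. \<sigma> \<subseteq> {1..N} \<and> cell d U \<sigma> - (\<Union>j\<in>{1..N} - \<sigma>. U j) \<noteq> {}}"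

definition open_convex_realizable :: "nat \<Rightarrow> nat \<Rightarrow> nat set set \<Rightarrow> bool" where
  "open_convex_realizable d N C \<longleftrightarrow>
     (\<exists>U. (\<forall>i\<in>{1..N}. openin (Euclidean_space d) (U i) \<and> fun_convex (U i)) \<and>
          C = code_of d N U)"

text \<open>A code comes with its number \<open>N\<close> of neurons: it is a subset of the power set of
  \<open>{1..N}\<close>, and a realization consists of exactly \<open>N\<close> sets.\<close>

definition odim :: "nat \<Rightarrow> nat set set \<Rightarrow> enat" where
  "odim N C =
     (if \<exists>d. open_convex_realizable d N C
      then enat (LEAST d. open_convex_realizable d N C) else \<infinity>)"

definition S_code :: "nat \<Rightarrow> nat set set" where
  "S_code n =
     {{1..n}} \<union> {{i} | i. i \<in> {1..n+1}} \<union> {{i, n+1} | i. i \<in> {1..n}} \<union> {{}}"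

end

theory Submission
  imports Defs "HOL-Library.Function_Algebras"
begin

text \<open>
  The lower bound is a dimension-free sunflower theorem: if \<open>U\<^sub>k\<close> (\<open>k \<in> A\<close>) are convex open sets whose
  pairwise intersections lie in a common convex open core \<open>C\<close>, and the vectors \<open>p\<^sub>k - c\<close> with
  \<open>p\<^sub>k \<in> U\<^sub>k\<close> and \<open>c \<in> C\<close> are linearly dependent, then some convex combination of the \<open>p\<^sub>k\<close> lies in
  \<open>C\<close>. In dimension \<open>d < n\<close> the vectors are always dependent, so the convex set \<open>U\<^sub>n\<^sub>+\<^sub>1\<close>, which meets all
  petals, would meet the core.

  The sunflower theorem is proved by induction on \<open>A\<close>. In a counterexample, the hyperplane through all
  \<open>p\<^sub>k\<close> but a suitable one misses \<open>C\<close> inside the affine span \<open>L\<close> of \<open>c\<close> and the \<open>p\<^sub>k\<close>. Shift it towards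
  \<open>c\<close> until it supports \<open>C \<inter> L\<close>, and move all the points to it along the segments to \<open>c\<close>, giving points
  \<open>v\<^sub>k\<close> with a relation \<open>\<Sum>\<mu>\<^sub>k v\<^sub>k = 0\<close>, \<open>\<Sum>\<mu>\<^sub>k = 0\<close>. Two of the \<open>\<mu>\<^sub>k\<close> have the same sign, so \<open>v\<^sub>i\<close> and \<open>v\<^sub>j\<close>
  lie on opposite sides of the span of the others. Tilting the hyperplane slightly about a parallel
  of that span, with either \<open>v\<^sub>i\<close> or \<open>v\<^sub>j\<close> raised, makes it cross \<open>C\<close>, contradicting the induction
  hypothesis for \<open>A - {j}\<close> or \<open>A - {i}\<close>.
\<close>

section \<open>Convex sunflowers in a real vector space\<close>

definition alg_open_in :: "'a::real_vector set \<Rightarrow> 'a set \<Rightarrow> bool" where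
  "alg_open_in V S \<longleftrightarrow> S \<subseteq> V \<and> (\<forall>x\<in>S. \<forall>w\<in>V. \<forall>\<^sub>F t in nhds 0. x + t *\<^sub>R w \<in> S)"

lemma alg_open_inD:
  assumes "alg_open_in V S" "x \<in> S" "w \<in> V"
  shows "\<forall>\<^sub>F t in at_right 0. x + t *\<^sub>R w \<in> S"
proof -
  have "\<forall>\<^sub>F t in nhds 0. x + t *\<^sub>R w \<in> S"
    using assms unfolding alg_open_in_def by blast
  then show ?thesis unfolding eventually_at_filter by (rule eventually_mono) blast
qed

text \<open>\<open>C\<close> is the core and the \<open>U k\<close> are the petals; the inclusions
  force distinct petals to meet in exactly \<open>C\<close>. Openness is asked only along lines
  inside \<open>V\<close>, so neither a topology on the space nor finite dimension enters.\<close>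

definition sunflower :: "'a::real_vector set \<Rightarrow> 'a set \<Rightarrow> ('i \<Rightarrow> 'a set) \<Rightarrow> 'i set \<Rightarrow> bool" where
  "sunflower V C U A \<longleftrightarrow> subspace V \<and> convex C \<and> alg_open_in V C \<and>
     (\<forall>k\<in>A. convex (U k) \<and> alg_open_in V (U k) \<and> C \<subseteq> U k) \<and>
     (\<forall>i\<in>A. \<forall>j\<in>A. i \<noteq> j \<longrightarrow> U i \<inter> U j \<subseteq> C)"

text \<open>Weights attach to indices instead of points of a convex hull, so that \<open>p\<close>
  need not be injective.\<close>

definition hull_meets :: "'a::real_vector set \<Rightarrow> ('i \<Rightarrow> 'a) \<Rightarrow> 'i set \<Rightarrow> bool" where
  "hull_meets C p A \<longleftrightarrow>
     (\<exists>w. (\<forall>k\<in>A. 0 \<le> w k) \<and> sum w A = 1 \<and> (\<Sum>k\<in>A. w k *\<^sub>R p k) \<in> C)"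

lemma sunflower_subset: "sunflower V C U A \<Longrightarrow> S \<subseteq> A \<Longrightarrow> sunflower V C U S"
  unfolding sunflower_def by (elim conjE, intro conjI ballI impI) (simp_all add: in_mono)

lemma hull_meets_mono:
  assumes "hull_meets C p S" "S \<subseteq> A" "finite A"
  shows "hull_meets C p A"
proof -
  obtain w where w: "\<forall>k\<in>S. 0 \<le> w k" "sum w S = 1" "(\<Sum>k\<in>S. w k *\<^sub>R p k) \<in> C"
    using assms(1) unfolding hull_meets_def by blast
  define w' where "w' k = (if k \<in> S then w k else 0)" for k
  have "sum w' A = sum w S"
    using assms by (intro sum.mono_neutral_cong_right) (auto simp: w'_def)
  moreover have "(\<Sum>k\<in>A. w' k *\<^sub>R p k) = (\<Sum>k\<in>S. w k *\<^sub>R p k)"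
    using assms by (intro sum.mono_neutral_cong_right) (auto simp: w'_def)
  ultimately show ?thesis
    unfolding hull_meets_def using w by (intro exI[of _ w']) (auto simp: w'_def)
qed

section \<open>Affine coordinates and tilted hyperplanes\<close>

lemma affine_combination_shift:
  fixes p :: "'i \<Rightarrow> 'a::real_vector"
  assumes "sum w A = 1"
  shows "(\<Sum>k\<in>A. w k *\<^sub>R p k) = c + (\<Sum>k\<in>A. w k *\<^sub>R (p k - c))"
proof -
  have "(\<Sum>k\<in>A. w k *\<^sub>R c) = c"
    unfolding scaleR_left.sum[symmetric] assms by simp
  then show ?thesis
    by (simp add: scaleR_diff_right sum_subtractf)
qed

lemma convex_segment_point:
  fixes c x :: "'a::real_vector"
  assumes "convex S" "c \<in> S" "x \<in> S" "0 \<le> t" "t \<le> 1"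
  shows "c + t *\<^sub>R (x - c) \<in> S"
proof -
  have "(1 - t) *\<^sub>R c + t *\<^sub>R x \<in> S"
    using assms by (intro convexD) auto
  then show ?thesis by (simp add: algebra_simps)
qed

text \<open>Give \<open>d i\<close> the weight \<open>1 / (1 + e)\<close> and the other
  \<open>d k\<close> the weight \<open>1 / (1 - e\<^sup>2)\<close>: every \<open>p k - c\<close>
  then has value 1, and the point given by \<tau> has value \<open>N\<close>, which is at least 1.
  As \<open>c\<close> has value 0, the segment between them, contained in \<open>C\<close>, crosses
  the affine span of the \<open>p k\<close>. Only coefficients are used, since the
  \<open>d k\<close> may be linearly dependent.\<close>

lemma tilted_hyperplane_crosses:
  fixes d :: "'i \<Rightarrow> 'a::real_vector"
  assumes R: "finite R" "i \<notin> R" and C: "convex C" "c \<in> C"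
    and x: "c + (\<Sum>k\<in>insert i R. \<tau> k *\<^sub>R d k) \<in> C"
    and \<tau>i: "\<tau> i \<le> 0" and e: "0 < e" "e < 1"
    and top: "sum \<tau> (insert i R) \<ge> 1 - e\<^sup>2"
    and p: "\<And>k. k \<in> R \<Longrightarrow> p k = c + d k + e *\<^sub>R (d i - d k)" "p i = c + d i + e *\<^sub>R d i"
  obtains \<rho> b where "b \<in> C" "sum \<rho> (insert i R) = 1"
    "(\<Sum>k\<in>insert i R. \<rho> k *\<^sub>R (p k - b)) = 0"
proof -
  define T where "T = sum \<tau> R"
  define N where "N = (T + (1 - e) * \<tau> i) / (1 - e\<^sup>2)"
  define \<sigma> where "\<sigma> = 1 / N"
  \<comment> \<open>Found by comparing the coefficients of the \<open>d k\<close> in the expansion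
    of \<open>b - c\<close> along the \<open>p k - c\<close>:
    \<open>\<rho> k * (1 - e) = \<sigma> * \<tau> k\<close> on \<open>R\<close>, and
    \<open>\<rho> i * (1 + e) + e * sum \<rho> R = \<sigma> * \<tau> i\<close>.\<close>
  define \<rho> where "\<rho> k = (if k = i then (\<sigma> * \<tau> i - e * \<sigma> * T / (1 - e)) / (1 + e) else \<sigma> * \<tau> k / (1 - e))" for k
  have e2: "e\<^sup>2 < 1" using e by (simp add: power_less_one_iff)
  have "e * \<tau> i \<le> 0" using e \<tau>i by (simp add: mult_nonneg_nonpos)
  then have "N \<ge> 1"
    using top e2 R unfolding N_def T_def by (simp add: field_simps)
  then have \<sigma>: "0 \<le> \<sigma>" "\<sigma> \<le> 1" "\<sigma> * N = 1" by (auto simp: \<sigma>_def)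
  have \<rho>R: "sum \<rho> R = \<sigma> * T / (1 - e)"
  proof -
    have "sum \<rho> R = (\<Sum>k\<in>R. \<sigma> / (1 - e) * \<tau> k)"
      using R by (intro sum.cong) (auto simp: \<rho>_def)
    then show ?thesis by (simp add: T_def sum_distrib_left sum_divide_distrib)
  qed
  have ne: "1 - e \<noteq> 0" "1 + e \<noteq> 0" "1 - e\<^sup>2 \<noteq> 0" "1 - e\<^sup>2 = (1 - e) * (1 + e)"
    using e e2 by (auto simp: power2_eq_square algebra_simps)
  have \<rho>i: "\<rho> i * (1 + e) = \<sigma> * \<tau> i - e * sum \<rho> R"
    using ne unfolding \<rho>R by (simp add: \<rho>_def)
  have N1: "\<sigma> * (T + (1 - e) * \<tau> i) = (1 - e) * (1 + e)"
    using \<sigma>(3) ne by (simp add: N_def divide_simps)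
  have rR: "(1 - e) * sum \<rho> R = \<sigma> * T" using ne by (simp add: \<rho>R)
  have "(1 - e) * (1 + e) * (\<rho> i + sum \<rho> R) = (1 - e) * (\<sigma> * \<tau> i - e * sum \<rho> R) + (1 + e) * ((1 - e) * sum \<rho> R)"
    unfolding \<rho>i[symmetric] by (simp add: algebra_simps)
  also have "\<dots> = (1 - e) * \<sigma> * \<tau> i + \<sigma> * T"
    unfolding rR[symmetric] by (simp add: algebra_simps)
  also have "\<dots> = (1 - e) * (1 + e)"
    using N1 by (simp add: algebra_simps)
  finally have \<rho>1: "sum \<rho> (insert i R) = 1"
    using R ne by simp
  define b where "b = c + \<sigma> *\<^sub>R (\<Sum>k\<in>insert i R. \<tau> k *\<^sub>R d k)"
  have "b \<in> C"
    using convex_segment_point[OF C x \<sigma>(1,2)] by (simp add: b_def)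
  moreover have "(\<Sum>k\<in>insert i R. \<rho> k *\<^sub>R (p k - b)) = 0"
  proof -
    have 1: "(\<Sum>k\<in>R. \<rho> k *\<^sub>R (p k - c)) = \<sigma> *\<^sub>R (\<Sum>k\<in>R. \<tau> k *\<^sub>R d k) + (e * sum \<rho> R) *\<^sub>R d i"
    proof -
      have "(\<Sum>k\<in>R. \<rho> k *\<^sub>R (p k - c)) = (\<Sum>k\<in>R. \<sigma> *\<^sub>R (\<tau> k *\<^sub>R d k) + (e * \<rho> k) *\<^sub>R d i)"
      proof (rule sum.cong[OF refl])
        fix k assume k: "k \<in> R"
        then have "\<rho> k * (1 - e) = \<sigma> * \<tau> k" using R ne by (auto simp: \<rho>_def)
        moreover have "\<rho> k *\<^sub>R (p k - c) = (\<rho> k * (1 - e)) *\<^sub>R d k + (e * \<rho> k) *\<^sub>R d i"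
          unfolding p(1)[OF k] by (simp add: algebra_simps)
        ultimately show "\<rho> k *\<^sub>R (p k - c) = \<sigma> *\<^sub>R (\<tau> k *\<^sub>R d k) + (e * \<rho> k) *\<^sub>R d i" by simp
      qed
      then show ?thesis
        by (simp add: sum.distrib scaleR_right.sum sum_distrib_left scaleR_left.sum)
    qed
    have 2: "\<rho> i *\<^sub>R (p i - c) = (\<sigma> * \<tau> i) *\<^sub>R d i - (e * sum \<rho> R) *\<^sub>R d i"
    proof -
      have "\<rho> i *\<^sub>R (p i - c) = (\<rho> i * (1 + e)) *\<^sub>R d i"
        using p(2) by (simp add: algebra_simps)
      then show ?thesis unfolding \<rho>i by (simp add: algebra_simps)
    qed
    have "(\<Sum>k\<in>insert i R. \<rho> k *\<^sub>R p k) = b"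
      unfolding affine_combination_shift[OF \<rho>1, of p c] b_def
      using R 1 2 by (simp add: algebra_simps)
    then show ?thesis
      using affine_combination_shift[OF \<rho>1, of p b] by simp
  qed
  ultimately show ?thesis using \<rho>1 that by blast
qed

text \<open>Coordinates \<open>\<tau>\<close> with respect to the \<open>v k - c\<close> stand in for a supporting functional of \<open>C\<close>: its
  value is \<open>sum \<tau> A\<close>, which is below \<open>1\<close> on \<open>C\<close>, whereas every convex combination of the tilted points
  has value at least \<open>1\<close>.\<close>

lemma sunflower_tilt:
  fixes v :: "'i \<Rightarrow> 'a::real_vector"
  assumes sf: "sunflower V C U A" "finite A" and c: "c \<in> C"
    and IH: "\<And>S q b l. S \<subset> A \<Longrightarrow> \<forall>k\<in>S. q k \<in> U k \<Longrightarrow> b \<in> C \<Longrightarrow> \<exists>k\<in>S. l k \<noteq> 0 \<Longrightarrow>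
               (\<Sum>k\<in>S. l k *\<^sub>R (q k - b)) = 0 \<Longrightarrow> hull_meets C q S"
    and ij: "i \<in> A" "j \<in> A" "i \<noteq> j"
    and bound: "\<And>\<tau>. c + (\<Sum>k\<in>A. \<tau> k *\<^sub>R (v k - c)) \<in> C \<Longrightarrow> sum \<tau> A < 1"
    and x: "c + (\<Sum>k\<in>A. \<tau> k *\<^sub>R (v k - c)) \<in> C" "sum \<tau> A \<ge> 1 - e\<^sup>2"
    and \<tau>: "\<tau> j = 0" "\<tau> i \<le> 0" and e: "0 < e" "e < 1"
    and U: "\<And>k. k \<in> A - {i, j} \<Longrightarrow> v k + e *\<^sub>R (v i - v k) \<in> U k"
           "v i + e *\<^sub>R (v i - c) \<in> U i"
  shows False
proof -
  define R where "R = A - {i, j}"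
  define d where "d k = v k - c" for k
  \<comment> \<open>Measured by coefficient sums, the points indexed by \<open>R\<close> slide
    towards \<open>v i\<close> at constant height 1, while \<open>p i\<close> rises to height
    \<open>1 + e\<close>.\<close>
  define p where "p k = (if k = i then v i + e *\<^sub>R (v i - c) else v k + e *\<^sub>R (v i - v k))" for k
  have R: "finite R" "i \<notin> R" "j \<notin> insert i R"
    and A: "A = insert j (insert i R)"
    using sf(2) ij by (auto simp: R_def)
  have sumA: "sum f A = f j + sum f (insert i R)" for f :: "'i \<Rightarrow> 'b::comm_monoid_add"
    unfolding A using R by simp
  have C: "convex C" using sf by (simp add: sunflower_def)
  have x': "c + (\<Sum>k\<in>insert i R. \<tau> k *\<^sub>R d k) \<in> C" "sum \<tau> (insert i R) \<ge> 1 - e\<^sup>2"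
    using x \<tau>(1) by (simp_all add: sumA d_def)
  have p: "p k = c + d k + e *\<^sub>R (d i - d k)" if "k \<in> R" for k
    using that R by (auto simp: p_def d_def)
  have pi: "p i = c + d i + e *\<^sub>R d i"
    by (simp add: p_def d_def)
  obtain \<rho> b where \<rho>: "b \<in> C" "sum \<rho> (insert i R) = 1" "(\<Sum>k\<in>insert i R. \<rho> k *\<^sub>R (p k - b)) = 0"
    using tilted_hyperplane_crosses[OF R(1,2) C c x'(1) \<tau>(2) e x'(2), of p] p pi by blast
  \<comment> \<open>Dropping \<open>j\<close> shrinks the index set, and the core point
    \<open>b\<close> in the affine span of the tilted points supplies the required relation.\<close>
  have "hull_meets C p (insert i R)"
  proof (rule IH[OF _ _ \<rho>(1) _ \<rho>(3)])
    show "insert i R \<subset> A" using R A by blast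
    show "\<forall>k\<in>insert i R. p k \<in> U k" using U R(2,3) unfolding p_def by (auto simp: R_def)
    show "\<exists>k\<in>insert i R. \<rho> k \<noteq> 0" using \<rho>(2) sum.not_neutral_contains_not_neutral[of \<rho> "insert i R"] by auto
  qed
  then obtain w where w: "\<forall>k\<in>insert i R. 0 \<le> w k" "sum w (insert i R) = 1"
      "(\<Sum>k\<in>insert i R. w k *\<^sub>R p k) \<in> C"
    unfolding hull_meets_def by blast
  \<comment> \<open>These are the coefficients of the \<open>d k\<close> in the convex combination
    of tilted points. They add up to \<open>1 + e * w i\<close>, too high for a point of
    \<open>C\<close>.\<close>
  define \<theta> where "\<theta> k = (if k = j then 0 else if k = i then w i * (1 + e) + e * sum w R else (1 - e) * w k)" for k
  have \<theta>R: "sum \<theta> R = (1 - e) * sum w R"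
    using R unfolding sum_distrib_left by (intro sum.cong) (auto simp: \<theta>_def)
  have "(\<Sum>k\<in>R. w k *\<^sub>R (p k - c)) = (\<Sum>k\<in>R. \<theta> k *\<^sub>R d k + (e * w k) *\<^sub>R d i)"
  proof (rule sum.cong[OF refl])
    fix k assume k: "k \<in> R"
    then have "\<theta> k = (1 - e) * w k" using R by (auto simp: \<theta>_def)
    then show "w k *\<^sub>R (p k - c) = \<theta> k *\<^sub>R d k + (e * w k) *\<^sub>R d i"
      using p[OF k] by (simp only:) (simp add: algebra_simps)
  qed
  then have wR: "(\<Sum>k\<in>R. w k *\<^sub>R (p k - c)) = (\<Sum>k\<in>R. \<theta> k *\<^sub>R d k) + (e * sum w R) *\<^sub>R d i"
    unfolding sum.distrib sum_distrib_left scaleR_left.sum by assumption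
  have \<theta>ij: "\<theta> j = 0" "\<theta> i = w i * (1 + e) + e * sum w R"
    using ij by (auto simp: \<theta>_def)
  have "w i *\<^sub>R (p i - c) + (e * sum w R) *\<^sub>R d i = \<theta> i *\<^sub>R d i"
    unfolding pi \<theta>ij by (simp add: algebra_simps)
  then have "(\<Sum>k\<in>insert i R. w k *\<^sub>R (p k - c)) = (\<Sum>k\<in>A. \<theta> k *\<^sub>R d k)"
    unfolding sumA \<theta>ij(1) sum.insert[OF R(1,2)] wR by simp
  then have "c + (\<Sum>k\<in>A. \<theta> k *\<^sub>R (v k - c)) \<in> C"
    using w(3) unfolding affine_combination_shift[OF w(2), of p c] d_def by simp
  then have "sum \<theta> A < 1"
    by (rule bound)
  moreover have "sum \<theta> A = sum w (insert i R) + e * w i"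
    unfolding sumA sum.insert[OF R(1,2)] \<theta>R \<theta>ij by (simp add: algebra_simps)
  moreover have "e * w i \<ge> 0" using w(1) e by simp
  ultimately show False using w(2) by simp
qed

text \<open>The situation after rescaling: all \<open>v k\<close> lie at height 1, a height that
  \<open>C\<close> approaches but never reaches. Two entries of \<mu> with the same sign leave a
  choice of which index to drop, and one of the two choices always meets the sign conditions of
  \<open>sunflower_tilt\<close>.\<close>

lemma sunflower_normalized:
  fixes v :: "'i \<Rightarrow> 'a::real_vector"
  assumes sf: "sunflower V C U A" "finite A" and c: "c \<in> C" and v: "\<And>k. k \<in> A \<Longrightarrow> v k \<in> U k"
    and IH: "\<And>S q b l. S \<subset> A \<Longrightarrow> \<forall>k\<in>S. q k \<in> U k \<Longrightarrow> b \<in> C \<Longrightarrow> \<exists>k\<in>S. l k \<noteq> 0 \<Longrightarrow>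
               (\<Sum>k\<in>S. l k *\<^sub>R (q k - b)) = 0 \<Longrightarrow> hull_meets C q S"
    and A: "2 \<le> card A"
    and \<mu>: "\<And>k. k \<in> A \<Longrightarrow> \<mu> k \<noteq> 0" "sum \<mu> A = 0" "(\<Sum>k\<in>A. \<mu> k *\<^sub>R (v k - c)) = 0"
    and bound: "\<And>\<tau>. c + (\<Sum>k\<in>A. \<tau> k *\<^sub>R (v k - c)) \<in> C \<Longrightarrow> sum \<tau> A < 1"
    and sup: "\<And>\<delta>. 0 < \<delta> \<Longrightarrow> \<exists>\<tau>. c + (\<Sum>k\<in>A. \<tau> k *\<^sub>R (v k - c)) \<in> C \<and> sum \<tau> A > 1 - \<delta>"
  shows False
proof -
  have "\<exists>i\<in>A. \<exists>j\<in>A. i \<noteq> j \<and> \<mu> i * \<mu> j > 0"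
  proof (cases "card A = 2")
    case True
    then obtain i j where ij: "A = {i, j}" "i \<noteq> j"
      by (meson card_2_iff)
    \<comment> \<open>With two petals the relation makes \<open>v i\<close> and \<open>v j\<close>
      coincide, so this point lies in the core although its height is 1.\<close>
    then have "\<mu> j = - \<mu> i" using \<mu>(2) by simp
    then have "\<mu> i *\<^sub>R (v i - v j) = 0"
      using \<mu>(3) ij by (simp add: algebra_simps)
    then have "v i = v j" using \<mu>(1) ij by simp
    then have "v i \<in> C" using v[of i] v[of j] ij sf(1) by (auto simp: sunflower_def)
    then have "c + (\<Sum>k\<in>A. (if k = i then 1 else 0) *\<^sub>R (v k - c)) \<in> C"
      using ij by simp
    from bound[OF this] show ?thesis using ij by simp
  next
    case False
    then have "3 \<le> card A" using A by simp
    then obtain B where B: "B \<subseteq> A" "card B = 3"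
      by (rule obtain_subset_with_card_n)
    then obtain x y z where xyz: "x \<in> A" "y \<in> A" "z \<in> A" "x \<noteq> y" "x \<noteq> z" "y \<noteq> z"
      unfolding card_3_iff by auto
    then have "\<mu> x * \<mu> y > 0 \<or> \<mu> x * \<mu> z > 0 \<or> \<mu> y * \<mu> z > 0"
      using \<mu>(1)[of x] \<mu>(1)[of y] \<mu>(1)[of z] by (auto simp: zero_less_mult_iff)
    then show ?thesis using xyz by blast
  qed
  then obtain i j where ij: "i \<in> A" "j \<in> A" "i \<noteq> j" "\<mu> i * \<mu> j > 0" by blast
  \<comment> \<open>Scaling by \<open>\<mu> i\<close> makes the entries at both \<open>i\<close> and
    \<open>j\<close> positive.\<close>
  define \<nu> where "\<nu> k = \<mu> i * \<mu> k" for k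
  have \<nu>: "\<nu> i > 0" "\<nu> j > 0" "sum \<nu> A = 0"
    using ij \<mu>(2) by (auto simp: \<nu>_def zero_less_mult_iff sum_distrib_left[symmetric])
  have \<nu>0: "(\<Sum>k\<in>A. (s * \<nu> k) *\<^sub>R (v k - c)) = 0" for s
  proof -
    have "(\<Sum>k\<in>A. (s * \<nu> k) *\<^sub>R (v k - c)) = (s * \<mu> i) *\<^sub>R (\<Sum>k\<in>A. \<mu> k *\<^sub>R (v k - c))"
      unfolding scaleR_right.sum by (simp add: \<nu>_def mult_ac)
    then show ?thesis using \<mu>(3) by simp
  qed
  have V: "subspace V" using sf by (simp add: sunflower_def)
  have U: "alg_open_in V (U k)" "U k \<subseteq> V" if "k \<in> A" for k
    using sf that by (auto simp: sunflower_def alg_open_in_def)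
  have cV: "c \<in> V" using sf c by (auto simp: sunflower_def alg_open_in_def)
  have vV: "v k \<in> V" if "k \<in> A" for k using U v that by blast
  have ev: "\<forall>\<^sub>F e in at_right 0. v k + e *\<^sub>R (y - y') \<in> U k" if "k \<in> A" "y \<in> V" "y' \<in> V" for k y y'
    using that by (intro alg_open_inD[OF U(1)] v subspace_diff[OF V])
  have evA: "\<forall>\<^sub>F e in at_right 0. \<forall>k\<in>A. v k + e *\<^sub>R (y - v k) \<in> U k" if "y \<in> V" for y
    using that sf(2) vV by (intro eventually_ball_finite ballI ev) auto
  have "\<forall>\<^sub>F e in at_right (0::real). 0 < e \<and> e < 1 \<and>
      (\<forall>k\<in>A. v k + e *\<^sub>R (v i - v k) \<in> U k) \<and> (\<forall>k\<in>A. v k + e *\<^sub>R (v j - v k) \<in> U k) \<and>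
      v i + e *\<^sub>R (v i - c) \<in> U i \<and> v j + e *\<^sub>R (v j - c) \<in> U j"
    using ij cV vV
    by (intro eventually_conj evA ev eventually_at_right_less eventually_at_right_real[THEN eventually_mono, of 0 1]) auto
  then obtain e where e: "0 < e" "e < 1"
      "\<forall>k\<in>A. v k + e *\<^sub>R (v i - v k) \<in> U k" "\<forall>k\<in>A. v k + e *\<^sub>R (v j - v k) \<in> U k"
      "v i + e *\<^sub>R (v i - c) \<in> U i" "v j + e *\<^sub>R (v j - c) \<in> U j"
    using eventually_happens'[OF trivial_limit_at_right_real] by blast
  \<comment> \<open>The tilt \<open>e\<close> is fixed first, by openness of the petals; only then
    is a core point chosen within the tolerance \<open>e\<^sup>2\<close> of
    \<open>tilted_hyperplane_crosses\<close>.\<close>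
  obtain \<tau> where \<tau>: "c + (\<Sum>k\<in>A. \<tau> k *\<^sub>R (v k - c)) \<in> C" "sum \<tau> A > 1 - e\<^sup>2"
    using sup[of "e\<^sup>2"] e(1) by auto
  \<comment> \<open>Subtracting a multiple of the relation changes neither the point nor its height.
    With the larger of the two ratios as \<open>s\<close>, the coefficient of its own index becomes
    0 and the other one nonpositive; the index with coefficient 0 is dropped.\<close>
  have shift: "c + (\<Sum>k\<in>A. (\<tau> k - s * \<nu> k) *\<^sub>R (v k - c)) \<in> C" "(\<Sum>k\<in>A. \<tau> k - s * \<nu> k) \<ge> 1 - e\<^sup>2" for s
    using \<tau> \<nu>(3) \<nu>0[of s]
    by (simp_all add: scaleR_left_diff_distrib sum_subtractf sum_distrib_left[symmetric])
  show False
  proof (cases "\<tau> i / \<nu> i \<le> \<tau> j / \<nu> j")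
    case True
    show False
      by (rule sunflower_tilt[OF sf c IH ij(1,2,3) bound shift[of "\<tau> j / \<nu> j"] _ _ e(1,2)])
        (use True \<nu> e in \<open>auto simp: field_simps\<close>)
  next
    case False
    show False
      by (rule sunflower_tilt[OF sf c IH ij(2,1) ij(3)[symmetric] bound shift[of "\<tau> i / \<nu> i"] _ _ e(1,2)])
        (use False \<nu> e in \<open>auto simp: field_simps\<close>)
  qed
qed

section \<open>The sunflower theorem, by induction on the index set\<close>

theorem sunflower_hull_meets:
  fixes p :: "'i \<Rightarrow> 'a::real_vector"
  assumes "finite A" "sunflower V C U A" "\<forall>k\<in>A. p k \<in> U k" "c \<in> C"
    and "\<exists>k\<in>A. l k \<noteq> 0" "(\<Sum>k\<in>A. l k *\<^sub>R (p k - c)) = 0"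
  shows "hull_meets C p A"
  using assms
proof (induction A arbitrary: p c l rule: finite_psubset_induct)
  case (psubset A)
  note sf = psubset.prems(1) and p = psubset.prems(2) and c = psubset.prems(3)
    and l = psubset.prems(4,5)
  have IH: "hull_meets C q S" if "S \<subset> A" "\<forall>k\<in>S. q k \<in> U k" "b \<in> C" "\<exists>k\<in>S. m k \<noteq> 0"
      "(\<Sum>k\<in>S. m k *\<^sub>R (q k - b)) = 0" for S q b m
    using psubset.IH[OF that(1) sunflower_subset[OF sf] that(2-5)] that(1) by simp
  have fin: "finite A" by fact
  have V: "subspace V" and C: "convex C" "alg_open_in V C" "C \<subseteq> V"
    using sf by (auto simp: sunflower_def alg_open_in_def)
  have U: "convex (U k)" "U k \<subseteq> V" "C \<subseteq> U k" if "k \<in> A" for k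
    using sf that by (auto simp: sunflower_def alg_open_in_def)
  show ?case
  proof (rule ccontr)
    assume no: "\<not> hull_meets C p A"
    have noS: "\<not> hull_meets C p S" if "S \<subseteq> A" for S
      using no that fin hull_meets_mono[of C p S A] by blast
    \<comment> \<open>A vanishing coefficient would leave a nontrivial relation on a smaller index
      set.\<close>
    have l0: "l k \<noteq> 0" if k: "k \<in> A" for k
    proof
      assume 0: "l k = 0"
      have "(\<Sum>k\<in>A - {k}. l k *\<^sub>R (p k - c)) = 0"
        using l(2) unfolding sum.remove[OF fin k] by (simp add: 0)
      moreover have "\<exists>i\<in>A - {k}. l i \<noteq> 0" using l(1) 0 by auto
      ultimately have "hull_meets C p (A - {k})"
        using k p c by (intro IH) auto
      then show False using noS[of "A - {k}"] by simp
    qed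
    have pC: "p k \<notin> C" if "k \<in> A" for k
    proof
      assume "p k \<in> C"
      then have "hull_meets C p {k}"
        unfolding hull_meets_def by (intro exI[of _ "\<lambda>_. 1"]) simp
      then show False using noS[of "{k}"] that by simp
    qed
    have "card A \<noteq> 0" using l(1) fin by auto
    moreover have "card A \<noteq> 1"
    proof
      assume "card A = 1"
      then obtain k where "A = {k}" by (rule card_1_singletonE)
      then show False using l0[of k] l(2) pC[of k] c by simp
    qed
    ultimately have card: "2 \<le> card A" by simp
    define \<Lambda> where "\<Lambda> = sum l A"
    \<comment> \<open>If every \<open>l k\<close> had the sign of \<Lambda>, the weights
      \<open>l k / \<Lambda>\<close> would exhibit \<open>c\<close> itself as a convex combination.
      The index found here is the one whose point has height at least 1 over the others.\<close>
    have "\<exists>j\<in>A. l j * \<Lambda> \<le> 0"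
    proof (rule ccontr)
      assume "\<not> (\<exists>j\<in>A. l j * \<Lambda> \<le> 0)"
      then have pos: "l j * \<Lambda> > 0" if "j \<in> A" for j using that by force
      have \<Lambda>: "\<Lambda> \<noteq> 0" using pos l(1) by force
      have w: "(\<Sum>k\<in>A. l k / \<Lambda>) = 1"
        using \<Lambda> unfolding sum_divide_distrib[symmetric] by (simp add: \<Lambda>_def)
      have "(\<Sum>k\<in>A. (l k / \<Lambda>) *\<^sub>R (p k - c)) = (1 / \<Lambda>) *\<^sub>R (\<Sum>k\<in>A. l k *\<^sub>R (p k - c))"
        unfolding scaleR_right.sum by simp
      then have "(\<Sum>k\<in>A. (l k / \<Lambda>) *\<^sub>R p k) = c"
        unfolding affine_combination_shift[OF w, of p c] l(2) by simp
      moreover have "l k / \<Lambda> \<ge> 0" if "k \<in> A" for k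
        using pos[OF that] by (auto simp: zero_less_mult_iff intro: divide_nonneg_nonneg divide_nonpos_nonpos)
      ultimately have "hull_meets C p A"
        unfolding hull_meets_def using w c by (intro exI[of _ "\<lambda>k. l k / \<Lambda>"]) auto
      then show False using no by simp
    qed
    then obtain j where j: "j \<in> A" "l j * \<Lambda> \<le> 0" by blast
    define S where "S = A - {j}"
    have sumA: "sum f A = f j + sum f S" for f :: "'i \<Rightarrow> 'b::comm_monoid_add"
      unfolding S_def by (rule sum.remove[OF fin j(1)])
    have "card S \<noteq> 0" using card card_Diff_singleton[OF j(1)] by (simp add: S_def)
    then have "S \<noteq> {}" by force
    moreover have "finite S" "S \<subset> A" "j \<notin> S" using fin j(1) by (auto simp: S_def)
    ultimately have S: "finite S" "S \<subset> A" "j \<notin> S" "S \<noteq> {}" by simp_all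
    define d where "d k = p k - c" for k
    \<comment> \<open>Otherwise the segment from \<open>c\<close> to such a point would cross the
      affine span of the \<open>p k\<close> with \<open>k \<in> S\<close> inside \<open>C\<close>,
      and the induction hypothesis would apply to \<open>S\<close>.\<close>
    have lt1: "sum \<tau> S < 1" if \<tau>: "c + (\<Sum>k\<in>S. \<tau> k *\<^sub>R d k) \<in> C" for \<tau>
    proof (rule ccontr)
      assume "\<not> sum \<tau> S < 1"
      then have s: "sum \<tau> S \<ge> 1" by simp
      define t where "t = 1 / sum \<tau> S"
      have t: "0 \<le> t" "t \<le> 1" using s by (auto simp: t_def)
      define b where "b = c + t *\<^sub>R (\<Sum>k\<in>S. \<tau> k *\<^sub>R d k)"
      have b: "b \<in> C"
        using convex_segment_point[OF C(1) c \<tau> t] by (simp add: b_def)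
      have \<rho>: "(\<Sum>k\<in>S. t * \<tau> k) = 1"
        using s unfolding sum_distrib_left[symmetric] by (simp add: t_def)
      have "(\<Sum>k\<in>S. (t * \<tau> k) *\<^sub>R p k) = b"
        unfolding affine_combination_shift[OF \<rho>, of p c] b_def scaleR_right.sum by (simp add: d_def)
      then have "(\<Sum>k\<in>S. (t * \<tau> k) *\<^sub>R (p k - b)) = 0"
        using affine_combination_shift[OF \<rho>, of p b] by simp
      moreover have "\<exists>k\<in>S. t * \<tau> k \<noteq> 0"
        using \<rho> sum.not_neutral_contains_not_neutral[of "\<lambda>k. t * \<tau> k" S] by auto
      ultimately have "hull_meets C p S"
        using S p b by (intro IH) auto
      then show False using noS[of S] S by simp
    qed
    define X where "X = {sum \<tau> S |\<tau>. c + (\<Sum>k\<in>S. \<tau> k *\<^sub>R d k) \<in> C}"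
    define a where "a = Sup X"
    have bdd: "bdd_above X" unfolding X_def bdd_above_def using lt1 by (auto intro!: exI[of _ 1] less_imp_le)
    have X0: "0 \<in> X" using c by (auto simp: X_def intro!: exI[of _ "\<lambda>_. 0"])
    have a1: "a \<le> 1" unfolding a_def using X0 lt1 by (intro cSup_least) (auto simp: X_def less_imp_le)
    have upper: "sum \<tau> S \<le> a" if "c + (\<Sum>k\<in>S. \<tau> k *\<^sub>R d k) \<in> C" for \<tau>
      unfolding a_def using that by (intro cSup_upper[OF _ bdd]) (auto simp: X_def)
    have cV: "c \<in> V" using c C by blast
    have dV: "d k \<in> V" if "k \<in> A" for k
      unfolding d_def using p U cV that by (intro subspace_diff[OF V]) auto
    have a0: "a > 0"
    proof -
      obtain k where k: "k \<in> S" using S by blast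
      then have "k \<in> A" using S by blast
      have "\<forall>\<^sub>F t in at_right (0::real). 0 < t \<and> c + t *\<^sub>R d k \<in> C"
        by (intro eventually_conj eventually_at_right_less alg_open_inD[OF C(2) c dV[OF \<open>k \<in> A\<close>]])
      then obtain t where t: "0 < t" "c + t *\<^sub>R d k \<in> C"
        using eventually_happens'[OF trivial_limit_at_right_real] by blast
      have "(\<Sum>i\<in>S. (if i = k then t else 0) *\<^sub>R d i) = t *\<^sub>R d k"
        using k S by (simp add: if_distrib[of "\<lambda>r. r *\<^sub>R _"] cong: if_cong)
      then have "sum (\<lambda>i. if i = k then t else 0) S \<le> a"
        using t by (intro upper) simp
      then show ?thesis using t k S by simp
    qed
    \<comment> \<open>The supremum is not attained: a point at height \<open>a > 0\<close> could be
      pushed further away from \<open>c\<close> within \<open>C\<close>, by openness.\<close>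
    have lt: "sum \<tau> S < a" if \<tau>: "c + (\<Sum>k\<in>S. \<tau> k *\<^sub>R d k) \<in> C" for \<tau>
    proof (rule ccontr)
      assume "\<not> sum \<tau> S < a"
      then have s: "sum \<tau> S \<ge> a" by simp
      define y where "y = (\<Sum>k\<in>S. \<tau> k *\<^sub>R d k)"
      have "y \<in> V" unfolding y_def using dV S by (intro subspace_sum[OF V] subspace_scale[OF V]) auto
      then have "\<forall>\<^sub>F t in at_right (0::real). 0 < t \<and> (c + y) + t *\<^sub>R y \<in> C"
        using \<tau> by (intro eventually_conj eventually_at_right_less alg_open_inD[OF C(2)]) (simp_all add: y_def)
      then obtain t where t: "0 < t" "(c + y) + t *\<^sub>R y \<in> C"
        using eventually_happens'[OF trivial_limit_at_right_real] by blast
      have "c + (\<Sum>k\<in>S. ((1 + t) * \<tau> k) *\<^sub>R d k) = (c + y) + t *\<^sub>R y"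
        unfolding scaleR_scaleR[symmetric] scaleR_right.sum[symmetric] y_def[symmetric]
        by (simp add: algebra_simps)
      then have "(\<Sum>k\<in>S. (1 + t) * \<tau> k) \<le> a" using t by (intro upper) (simp add: add.assoc)
      then have "sum \<tau> S + t * sum \<tau> S \<le> a"
        unfolding sum_distrib_left[symmetric] by (simp add: algebra_simps)
      moreover have "t * sum \<tau> S > 0" using t s a0 by simp
      ultimately show False using s by simp
    qed
    \<comment> \<open>\<open>p j\<close> lies at height \<open>\<phi>\<close>, the points \<open>p k\<close> with \<open>k \<noteq> j\<close> at height \<open>1\<close>, and \<open>C\<close> below height \<open>a\<close>.\<close>
    define \<phi> where "\<phi> = 1 - \<Lambda> / l j"
    have "\<Lambda> / l j \<le> 0"
      using j l0[OF j(1)] by (auto simp: mult_le_0_iff divide_le_0_iff)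
    then have \<phi>: "\<phi> \<ge> 1" "l j * \<phi> = l j - \<Lambda>"
      using l0[OF j(1)] by (auto simp: \<phi>_def algebra_simps)
    \<comment> \<open>The factor bringing \<open>p k\<close> down to height \<open>a\<close> along
      its segment to \<open>c\<close>. Being at most 1, it keeps \<open>v k\<close> in the petal by
      convexity.\<close>
    define r where "r k = (if k = j then a / \<phi> else a)" for k
    have "a / \<phi> \<le> 1"
      using a1 \<phi> by simp
    then have r: "0 \<le> r k" "r k \<le> 1" for k
      using a0 a1 \<phi> by (auto simp: r_def)
    define v where "v k = c + r k *\<^sub>R d k" for k
    \<comment> \<open>The factor \<phi> compensates the extra division by \<phi> in
      \<open>r j\<close>, so the relation survives; its coefficients sum to 0 because all
      \<open>v k\<close> have the same height.\<close>
    define \<mu> where "\<mu> k = (if k = j then l j * \<phi> else l k)" for k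
    have vS: "(\<Sum>k\<in>S. \<tau> k *\<^sub>R (v k - c)) = (\<Sum>k\<in>S. (a * \<tau> k) *\<^sub>R d k)" for \<tau>
      using S by (intro sum.cong) (auto simp: v_def r_def mult_ac)
    have vj: "v j - c = (a / \<phi>) *\<^sub>R d j" by (simp add: v_def r_def)
    have \<mu>j: "\<mu> j = l j * \<phi>" by (simp add: \<mu>_def)
    have \<mu>S: "sum f S = sum g S" if "\<And>k. k \<noteq> j \<Longrightarrow> f k = g k" for f g :: "'i \<Rightarrow> 'b::comm_monoid_add"
      by (rule sum.cong[OF refl], rule that) (use S(3) in blast)
    have \<mu>0: "\<mu> k \<noteq> 0" if "k \<in> A" for k
      using l0 that j \<phi>(1) by (auto simp: \<mu>_def)
    have \<mu>sum: "sum \<mu> A = 0"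
    proof -
      have "sum \<mu> S = sum l S" by (rule \<mu>S) (simp add: \<mu>_def)
      then show ?thesis
        using sumA[of l] unfolding sumA \<mu>j \<phi>(2) \<Lambda>_def by simp
    qed
    have \<mu>rel: "(\<Sum>k\<in>A. \<mu> k *\<^sub>R (v k - c)) = 0"
    proof -
      have 1: "(\<Sum>k\<in>S. (a * \<mu> k) *\<^sub>R d k) = a *\<^sub>R (\<Sum>k\<in>S. l k *\<^sub>R d k)"
        unfolding scaleR_right.sum by (rule \<mu>S) (simp add: \<mu>_def)
      have 2: "l j *\<^sub>R d j + (\<Sum>k\<in>S. l k *\<^sub>R d k) = 0"
        using l(2) unfolding sumA d_def by simp
      have 3: "\<mu> j *\<^sub>R (v j - c) = a *\<^sub>R (l j *\<^sub>R d j)"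
        unfolding vj \<mu>j using \<phi>(1) by (simp add: mult_ac)
      show ?thesis
        unfolding sumA vS 1 3 scaleR_right_distrib[symmetric] 2 by simp
    qed
    \<comment> \<open>A multiple of \<mu> clears the entry at \<open>j\<close>, which reduces the
      claim to \<open>lt\<close> with heights measured in units of \<open>a\<close>.\<close>
    have bound: "sum \<tau> A < 1" if \<tau>: "c + (\<Sum>k\<in>A. \<tau> k *\<^sub>R (v k - c)) \<in> C" for \<tau>
    proof -
      define s where "s = \<tau> j / \<mu> j"
      define \<theta> where "\<theta> k = \<tau> k - s * \<mu> k" for k
      have "(\<Sum>k\<in>A. (s * \<mu> k) *\<^sub>R (v k - c)) = s *\<^sub>R (\<Sum>k\<in>A. \<mu> k *\<^sub>R (v k - c))"
        unfolding scaleR_right.sum by simp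
      then have 1: "(\<Sum>k\<in>A. \<theta> k *\<^sub>R (v k - c)) = (\<Sum>k\<in>A. \<tau> k *\<^sub>R (v k - c))"
        unfolding \<theta>_def scaleR_left_diff_distrib sum_subtractf \<mu>rel by simp
      have 2: "sum \<theta> A = sum \<tau> A"
        unfolding \<theta>_def sum_subtractf sum_distrib_left[symmetric] \<mu>sum by simp
      have "\<theta> j = 0" using \<mu>0[OF j(1)] by (simp add: \<theta>_def s_def)
      then have 3: "(\<Sum>k\<in>A. \<tau> k *\<^sub>R (v k - c)) = (\<Sum>k\<in>S. (a * \<theta> k) *\<^sub>R d k)" "sum \<tau> A = sum \<theta> S"
        using 1 2 sumA[of \<theta>] sumA[of "\<lambda>k. \<theta> k *\<^sub>R (v k - c)"] vS[of \<theta>] by simp_all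
      have "(\<Sum>k\<in>S. a * \<theta> k) < a"
        using \<tau> by (intro lt) (simp add: 3(1))
      then show ?thesis
        using a0 unfolding sum_distrib_left[symmetric] 3(2) by simp
    qed
    have sup: "\<exists>\<tau>. c + (\<Sum>k\<in>A. \<tau> k *\<^sub>R (v k - c)) \<in> C \<and> sum \<tau> A > 1 - \<delta>" if "0 < \<delta>" for \<delta>
    proof -
      have "a * (1 - \<delta>) < Sup X" using a0 that by (simp add: a_def[symmetric] algebra_simps)
      then obtain \<tau> where \<tau>: "a * (1 - \<delta>) < sum \<tau> S" "c + (\<Sum>k\<in>S. \<tau> k *\<^sub>R d k) \<in> C"
        using X0 bdd by (subst (asm) less_cSup_iff) (auto simp: X_def)
      define \<theta> where "\<theta> k = (if k = j then 0 else \<tau> k / a)" for k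
      have \<theta>j: "\<theta> j = 0" by (simp add: \<theta>_def)
      have "(\<Sum>k\<in>S. (a * \<theta> k) *\<^sub>R d k) = (\<Sum>k\<in>S. \<tau> k *\<^sub>R d k)"
        by (rule \<mu>S) (use a0 in \<open>simp add: \<theta>_def\<close>)
      then have "(\<Sum>k\<in>A. \<theta> k *\<^sub>R (v k - c)) = (\<Sum>k\<in>S. \<tau> k *\<^sub>R d k)"
        unfolding sumA vS \<theta>j by simp
      moreover have "sum \<theta> S = (\<Sum>k\<in>S. \<tau> k / a)"
        by (rule \<mu>S) (simp add: \<theta>_def)
      then have "sum \<theta> A = sum \<tau> S / a"
        unfolding sumA \<theta>j sum_divide_distrib by simp
      moreover have "sum \<tau> S / a > 1 - \<delta>" using \<tau>(1) a0 by (simp add: field_simps)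
      ultimately show ?thesis using \<tau>(2) by (intro exI[of _ \<theta>]) simp
    qed
    have vU: "v k \<in> U k" if "k \<in> A" for k
      unfolding v_def d_def using U(1,3)[OF that] p c that r by (intro convex_segment_point) auto
    show False
      by (rule sunflower_normalized[OF sf fin c vU IH card \<mu>0 \<mu>sum \<mu>rel bound sup])
  qed
qed

section \<open>The coordinate space as a real vector space\<close>

instantiation "fun" :: (type, real_vector) real_vector
begin

definition "scaleR r f = (\<lambda>x. r *\<^sub>R f x)"

instance
  by standard (simp_all add: scaleR_fun_def fun_eq_iff scaleR_right_distrib scaleR_left_distrib)

end

lemma scaleR_fun_apply [simp]: "(r *\<^sub>R f) x = r *\<^sub>R f x"
  by (simp add: scaleR_fun_def)

lemma sum_fun_apply: "sum f A x = (\<Sum>k\<in>A. f k x)"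
  by (induction A rule: infinite_finite_induct) auto

lemma fun_convex_iff_convex: "fun_convex S \<longleftrightarrow> convex S"
proof -
  have "(\<lambda>i. u * x i + v * y i) = u *\<^sub>R x + v *\<^sub>R y" for u v and x y :: "nat \<Rightarrow> real"
    by (simp add: fun_eq_iff)
  then show ?thesis unfolding fun_convex_def convex_def by simp
qed

lemma subspace_Euclidean_space: "subspace (topspace (Euclidean_space d))"
  by (rule subspaceI) (auto simp: topspace_Euclidean_space)

text \<open>The line through \<open>x\<close> in direction \<open>w\<close> is continuous for the
  product topology and never leaves the coordinate subspace.\<close>

lemma alg_open_in_Euclidean_space:
  assumes "openin (Euclidean_space d) S"
  shows "alg_open_in (topspace (Euclidean_space d)) S"
  unfolding alg_open_in_def
proof (intro conjI ballI)
  show "S \<subseteq> topspace (Euclidean_space d)" using assms by (rule openin_subset)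
  fix x w assume x: "x \<in> S" and w: "w \<in> topspace (Euclidean_space d)"
  obtain T where T: "open T" "S = T \<inter> {x. \<forall>i\<ge>d. x i = 0}"
    using assms by (auto simp: Euclidean_space_def openin_subtopology euclidean_product_topology)
  have cont: "continuous_on UNIV (\<lambda>t::real. x + t *\<^sub>R w)"
    by (intro continuous_on_coordinatewise_then_product) (simp add: continuous_intros)
  have "open ((\<lambda>t::real. x + t *\<^sub>R w) -` T)"
    using T(1) cont by (rule open_vimage)
  moreover have "0 \<in> (\<lambda>t::real. x + t *\<^sub>R w) -` T" using x T(2) by simp
  ultimately have "\<forall>\<^sub>F t in nhds 0. t \<in> (\<lambda>t::real. x + t *\<^sub>R w) -` T"
    by (rule eventually_nhds_in_open)
  then show "\<forall>\<^sub>F t in nhds 0. x + t *\<^sub>R w \<in> S"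
    by (rule eventually_mono) (use x w T(2) in \<open>auto simp: topspace_Euclidean_space\<close>)
qed

lemma exists_linear_relation:
  fixes q :: "'i \<Rightarrow> nat \<Rightarrow> real"
  assumes A: "finite A" "d < card A" and q: "\<And>k. k \<in> A \<Longrightarrow> q k \<in> topspace (Euclidean_space d)"
  obtains l where "\<exists>k\<in>A. l k \<noteq> 0" "(\<Sum>k\<in>A. l k *\<^sub>R q k) = 0"
proof (cases "inj_on q A")
  \<comment> \<open>\<open>dependent\<close> speaks about the set of values, so a repeated vector
    has to yield its relation separately.\<close>
  case False
  then obtain a b where ab: "a \<in> A" "b \<in> A" "a \<noteq> b" "q a = q b"
    by (auto simp: inj_on_def)
  define l :: "'i \<Rightarrow> real" where "l k = (if k = a then 1 else if k = b then -1 else 0)" for k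
  have "(\<Sum>k\<in>A. l k *\<^sub>R q k) = (\<Sum>k\<in>{a, b}. l k *\<^sub>R q k)"
    using A ab by (intro sum.mono_neutral_right) (auto simp: l_def)
  also have "\<dots> = 0" using ab by (simp add: l_def)
  finally have "(\<Sum>k\<in>A. l k *\<^sub>R q k) = 0" .
  moreover have "l a \<noteq> 0" by (simp add: l_def)
  ultimately show ?thesis using that[of l] ab(1) by blast
next
  case True
  define e :: "nat \<Rightarrow> nat \<Rightarrow> real" where "e i = (\<lambda>j. if j = i then 1 else 0)" for i
  have "q k \<in> span (e ` {..<d})" if "k \<in> A" for k
  proof -
    have "q k = (\<Sum>i<d. q k i *\<^sub>R e i)"
    proof
      fix j
      have "(\<Sum>i<d. q k i *\<^sub>R e i) j = (\<Sum>i<d. if j = i then q k i else 0)"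
        unfolding sum_fun_apply by (intro sum.cong) (auto simp: e_def)
      then show "q k j = (\<Sum>i<d. q k i *\<^sub>R e i) j"
        using q[OF that] by (auto simp: topspace_Euclidean_space)
    qed
    also have "\<dots> \<in> span (e ` {..<d})"
      by (intro span_sum span_scale span_base) auto
    finally show ?thesis .
  qed
  then have sub: "q ` A \<subseteq> span (e ` {..<d})" by blast
  have "dependent (q ` A)"
  proof (rule ccontr)
    assume "\<not> dependent (q ` A)"
    then have "card (q ` A) \<le> card (e ` {..<d})"
      using independent_span_bound[OF _ _ sub] by simp
    also have "\<dots> \<le> d" using card_image_le[of "{..<d}" e] by simp
    finally show False using A card_image[OF True] by simp
  qed
  then obtain u where u: "\<exists>v\<in>q ` A. u v \<noteq> 0" "(\<Sum>v\<in>q ` A. u v *\<^sub>R v) = 0"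
    using A by (auto simp: dependent_finite)
  have "(\<Sum>k\<in>A. u (q k) *\<^sub>R q k) = 0"
    using u(2) by (simp add: sum.reindex[OF True])
  then show ?thesis using that[of "u \<circ> q"] u(1) by auto
qed

section \<open>Codewords of points and the lower bound\<close>

lemma code_of_eq_image:
  "code_of d N U = (\<lambda>x. {i \<in> {1..N}. x \<in> U i}) ` topspace (Euclidean_space d)"
  (is "_ = ?\<sigma> ` _")
proof (intro equalityI subsetI)
  fix \<sigma> assume "\<sigma> \<in> code_of d N U"
  then obtain x where \<sigma>: "\<sigma> \<subseteq> {1..N}" and "x \<in> cell d U \<sigma> - (\<Union>j\<in>{1..N} - \<sigma>. U j)"
    unfolding code_of_def by blast
  then have x: "x \<in> topspace (Euclidean_space d)" "\<forall>i\<in>\<sigma>. x \<in> U i" "\<forall>j\<in>{1..N} - \<sigma>. x \<notin> U j"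
    unfolding cell_def by blast+
  then have "\<sigma> = ?\<sigma> x" using \<sigma> by blast
  then show "\<sigma> \<in> ?\<sigma> ` topspace (Euclidean_space d)" using x(1) by blast
next
  fix \<sigma> assume "\<sigma> \<in> ?\<sigma> ` topspace (Euclidean_space d)"
  then obtain x where "x \<in> topspace (Euclidean_space d)" "\<sigma> = ?\<sigma> x" by blast
  then show "\<sigma> \<in> code_of d N U" unfolding code_of_def cell_def by auto
qed

text \<open>A codeword with two members in \<open>{1..n}\<close> equals \<open>{1..n}\<close>. Hence
  the first \<open>n\<close> sets form a sunflower whose core avoids \<open>U (n + 1)\<close>, while
  the codewords \<open>{i, n + 1}\<close> place a point of \<open>U (n + 1)\<close> in every
  petal.\<close>

lemma S_code_lower_bound:
  assumes "n \<ge> 1" "open_convex_realizable d (n + 1) (S_code n)"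
  shows "n \<le> d"
proof (rule ccontr)
  assume "\<not> n \<le> d"
  then have dn: "d < n" by simp
  obtain U where U: "\<And>i. i \<in> {1..n+1} \<Longrightarrow> openin (Euclidean_space d) (U i) \<and> fun_convex (U i)"
      and code: "S_code n = code_of d (n + 1) U"
    using assms(2) unfolding open_convex_realizable_def by blast
  define E where "E = topspace (Euclidean_space d)"
  define \<sigma> where "\<sigma> x = {i \<in> {1..n+1}. x \<in> U i}" for x
  have \<sigma>: "S_code n = \<sigma> ` E"
    unfolding code code_of_eq_image \<sigma>_def E_def ..
  have inU: "i \<in> \<sigma> x \<longleftrightarrow> x \<in> U i" if "i \<in> {1..n+1}" for i x
    using that by (simp add: \<sigma>_def)
  \<comment> \<open>A single point yields a single codeword. This rules out \<open>n = 1\<close>,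
    where the core is \<open>U 1\<close> and does meet \<open>U 2\<close>.\<close>
  have d0: "d \<noteq> 0"
  proof
    assume "d = 0"
    then have "E = {\<lambda>_. 0}" by (auto simp: E_def topspace_Euclidean_space)
    moreover have "{} \<in> S_code n" "{1} \<in> S_code n" by (auto simp: S_code_def)
    ultimately show False unfolding \<sigma> by auto
  qed
  then have n2: "n \<ge> 2" using dn by simp
  define C where "C = (\<Inter>i\<in>{1..n}. U i)"
  have UE: "U i \<subseteq> E" if "i \<in> {1..n+1}" for i
    using U[OF that] unfolding E_def by (blast dest: openin_subset)
  have aU: "alg_open_in E (U i)" "convex (U i)" if "i \<in> {1..n+1}" for i
    using U[OF that] alg_open_in_Euclidean_space unfolding E_def by (auto simp: fun_convex_iff_convex)
  have "openin (Euclidean_space d) C"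
    unfolding C_def using U assms(1) by (intro openin_Inter) auto
  then have aC: "alg_open_in E C" unfolding E_def by (rule alg_open_in_Euclidean_space)
  have cC: "convex C" unfolding C_def using aU by (intro convex_INT) auto
  have full: "\<sigma> x = {1..n}" if x: "x \<in> E" "i \<in> \<sigma> x" "j \<in> \<sigma> x" "i \<in> {1..n}" "j \<in> {1..n}" "i \<noteq> j" for x i j
  proof -
    have "\<sigma> x \<in> S_code n" using x(1) \<sigma> by blast
    then have "\<sigma> x = {1..n} \<or> (\<exists>a. \<sigma> x = {a}) \<or> (\<exists>a. \<sigma> x = {a, n + 1}) \<or> \<sigma> x = {}"
      unfolding S_code_def by blast
    moreover have "\<sigma> x \<noteq> {a}" for a using x by force
    moreover have "\<sigma> x \<noteq> {a, n + 1}" for a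
    proof
      assume "\<sigma> x = {a, n + 1}"
      then have "i \<in> {a, n + 1}" "j \<in> {a, n + 1}" using x(2,3) by simp_all
      then show False using x(4-6) by auto
    qed
    ultimately show ?thesis using x(2) by blast
  qed
  have disj: "C \<inter> U (n + 1) = {}"
  proof (rule ccontr)
    assume "C \<inter> U (n + 1) \<noteq> {}"
    then obtain x where x: "x \<in> C" "x \<in> U (n + 1)" by blast
    then have "\<sigma> x = {1..n}"
      using n2 UE[of "n + 1"] by (intro full[of x 1 2]) (auto simp: inU C_def)
    moreover have "n + 1 \<in> \<sigma> x" using x by (simp add: inU)
    ultimately show False by simp
  qed
  have sf: "sunflower E C U {1..n}"
    unfolding sunflower_def
  proof (intro conjI ballI impI)
    show "subspace E" unfolding E_def by (rule subspace_Euclidean_space)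
    show "C \<subseteq> U k" if "k \<in> {1..n}" for k using that by (auto simp: C_def)
    fix i j assume ij: "i \<in> {1..n}" "j \<in> {1..n}" "i \<noteq> j"
    show "U i \<inter> U j \<subseteq> C"
    proof
      fix x assume x: "x \<in> U i \<inter> U j"
      then have "\<sigma> x = {1..n}"
        using ij UE[of i] by (intro full[of x i j]) (auto simp: inU)
      then have "x \<in> U k" if "k \<in> {1..n}" for k using that inU[of k x] by simp
      then show "x \<in> C" by (simp add: C_def)
    qed
  qed (use aC cC aU in auto)
  have "{1..n} \<in> \<sigma> ` E" unfolding \<sigma>[symmetric] by (simp add: S_code_def)
  then obtain c where c: "c \<in> E" "{1..n} = \<sigma> c" by blast
  have "c \<in> U k" if "k \<in> {1..n}" for k using that c(2) unfolding \<sigma>_def by blast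
  then have cin: "c \<in> C" by (simp add: C_def)
  have "\<exists>x. x \<in> U i \<and> x \<in> U (n + 1)" if i: "i \<in> {1..n}" for i
  proof -
    have "{i, n + 1} \<in> \<sigma> ` E" unfolding \<sigma>[symmetric] using i by (auto simp: S_code_def)
    then obtain x where "{i, n + 1} = \<sigma> x" by blast
    then have "i \<in> \<sigma> x" "n + 1 \<in> \<sigma> x" by auto
    then show ?thesis unfolding \<sigma>_def by blast
  qed
  then obtain p where p: "\<And>i. i \<in> {1..n} \<Longrightarrow> p i \<in> U i \<and> p i \<in> U (n + 1)" by metis
  have "p k - c \<in> E" if k: "k \<in> {1..n}" for k
  proof -
    have "p k \<in> E" using p[OF k] UE[of k] k by auto
    then show ?thesis using c(1) subspace_Euclidean_space unfolding E_def by (intro subspace_diff)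
  qed
  then obtain l where "\<exists>k\<in>{1..n}. l k \<noteq> 0" "(\<Sum>k\<in>{1..n}. l k *\<^sub>R (p k - c)) = 0"
    using exists_linear_relation[of "{1..n}" d "\<lambda>k. p k - c"] dn unfolding E_def by auto
  then have "hull_meets C p {1..n}"
    using p cin by (intro sunflower_hull_meets[OF _ sf, of p c l]) auto
  then obtain w where w: "\<forall>k\<in>{1..n}. 0 \<le> w k" "sum w {1..n} = 1" "(\<Sum>k\<in>{1..n}. w k *\<^sub>R p k) \<in> C"
    unfolding hull_meets_def by blast
  have "(\<Sum>k\<in>{1..n}. w k *\<^sub>R p k) \<in> U (n + 1)"
    using w p aU(2)[of "n + 1"] by (intro convex_sum) auto
  then show False using w(3) disj by blast
qed

section \<open>A realization in dimension \<open>n\<close>\<close>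

text \<open>The petal \<open>i\<close> is elongated along coordinate \<open>i - 1\<close>. Its upper bound \<open>n + 2\<close> and lower bound \<open>-1\<close>
  matter only for \<open>n = 1\<close>, where the petal would otherwise contain the half-space or be the whole line.\<close>

definition S_realization :: "nat \<Rightarrow> nat \<Rightarrow> (nat \<Rightarrow> real) set" where
  "S_realization n i = topspace (Euclidean_space n) \<inter>
     (if i \<le> n then {x. \<forall>j\<in>{..<n}. -1 < x j \<and> x j < (if j + 1 = i then real n + 2 else 1)}
      else {x. real n < (\<Sum>j<n. x j)})"

lemma openin_S_realization: "openin (Euclidean_space n) (S_realization n i)"
proof -
  define T where "T = (if i \<le> n then {x :: nat \<Rightarrow> real. \<forall>j\<in>{..<n}. -1 < x j \<and> x j < (if j + 1 = i then real n + 2 else 1)}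
      else {x. real n < (\<Sum>j<n. x j)})"
  have coord: "continuous_on UNIV (\<lambda>x :: nat \<Rightarrow> real. x j)" for j
    by (rule continuous_on_product_coordinates)
  have box: "open {x :: nat \<Rightarrow> real. -1 < x j \<and> x j < b}" for j b
    by (intro open_Collect_conj open_Collect_less coord continuous_on_const)
  have "open {x :: nat \<Rightarrow> real. \<forall>j\<in>{..<n}. -1 < x j \<and> x j < (if j + 1 = i then real n + 2 else 1)}"
    unfolding Collect_ball_eq by (rule open_INT[OF finite_lessThan]) (rule ballI, rule box)
  moreover have "open {x :: nat \<Rightarrow> real. real n < (\<Sum>j<n. x j)}"
    by (intro open_Collect_less continuous_on_const continuous_on_sum coord)
  ultimately have "open T" unfolding T_def by (simp only: if_split) blast
  moreover have "S_realization n i = T \<inter> {x. \<forall>i\<ge>n. x i = 0}"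
    unfolding S_realization_def T_def topspace_Euclidean_space by (rule Int_commute)
  ultimately show ?thesis
    unfolding Euclidean_space_def openin_subtopology euclidean_product_topology[symmetric]
    by (auto simp: euclidean_product_topology)
qed

lemma fun_convex_S_realization: "fun_convex (S_realization n i)"
proof -
  have 1: "convex {x :: nat \<Rightarrow> real. a < x j \<and> x j < b}" for j a b
  proof -
    have "{x :: nat \<Rightarrow> real. a < x j \<and> x j < b} = (\<lambda>x. x j) -` {a<..<b}" by auto
    moreover have "linear (\<lambda>x :: nat \<Rightarrow> real. x j)" by (rule linearI) auto
    ultimately show ?thesis by (simp add: convex_linear_vimage)
  qed
  have 2: "convex {x :: nat \<Rightarrow> real. real n < (\<Sum>j<n. x j)}"
  proof -
    have "{x :: nat \<Rightarrow> real. real n < (\<Sum>j<n. x j)} = (\<lambda>x. \<Sum>j<n. x j) -` {real n<..}" by auto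
    moreover have "linear (\<lambda>x :: nat \<Rightarrow> real. \<Sum>j<n. x j)"
      by (rule linearI) (auto simp: sum.distrib sum_distrib_left)
    ultimately show ?thesis by (simp add: convex_linear_vimage)
  qed
  have "convex {x :: nat \<Rightarrow> real. \<forall>j\<in>{..<n}. -1 < x j \<and> x j < (if j + 1 = i then real n + 2 else 1)}"
    unfolding Collect_ball_eq by (intro convex_INT 1)
  then show ?thesis
    unfolding fun_convex_iff_convex S_realization_def
    using 2 by (intro convex_Int[OF subspace_imp_convex[OF subspace_Euclidean_space]]) (simp only: if_split, blast)
qed

text \<open>Coordinate \<open>i - 1\<close> may reach 1 only in petal \<open>i\<close>, so two
  different petals meet only in the open cube with all coordinates between -1 and 1. That cube lies
  in every petal and misses the half-space.\<close>

lemma S_code_eq_code_of: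
  assumes n: "n \<ge> 1"
  shows "S_code n = code_of n (n + 1) (S_realization n)"
proof -
  define \<sigma> where "\<sigma> x = {i \<in> {1..n+1}. x \<in> S_realization n i}" for x
  let ?E = "topspace (Euclidean_space n)"
  have mem: "i \<in> \<sigma> x \<longleftrightarrow> (\<forall>j<n. -1 < x j \<and> x j < (if j + 1 = i then real n + 2 else 1))"
    if "x \<in> ?E" "i \<in> {1..n}" for i x
    using that by (auto simp: \<sigma>_def S_realization_def)
  have mem': "n + 1 \<in> \<sigma> x \<longleftrightarrow> real n < (\<Sum>j<n. x j)" if "x \<in> ?E" for x
    using that by (auto simp: \<sigma>_def S_realization_def)
  have sub: "\<sigma> x \<subseteq> insert (n + 1) {1..n}" for x by (auto simp: \<sigma>_def)
  have "\<sigma> x \<in> S_code n" if x: "x \<in> ?E" for x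
  proof (cases "\<exists>i j. i \<in> {1..n} \<and> j \<in> {1..n} \<and> i \<noteq> j \<and> i \<in> \<sigma> x \<and> j \<in> \<sigma> x")
    case True
    then obtain i j where ij: "i \<in> {1..n}" "j \<in> {1..n}" "i \<noteq> j" "i \<in> \<sigma> x" "j \<in> \<sigma> x" by blast
    have lt: "-1 < x k \<and> x k < 1" if "k < n" for k
    proof (cases "k + 1 = i")
      case True
      then show ?thesis using ij(3,5) that unfolding mem[OF x ij(2)] by force
    next
      case False
      then show ?thesis using ij(4) that unfolding mem[OF x ij(1)] by force
    qed
    have "k \<in> \<sigma> x" if "k \<in> {1..n}" for k
      unfolding mem[OF x that] using lt by force
    moreover have "n + 1 \<notin> \<sigma> x"
      unfolding mem'[OF x] using sum_bounded_above[of "{..<n}" x 1] lt by force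
    ultimately have "\<sigma> x = {1..n}" using sub[of x] by blast
    then show ?thesis by (simp add: S_code_def)
  next
    case False
    then consider "\<sigma> x \<subseteq> {n + 1}" | i where "i \<in> {1..n}" "\<sigma> x \<subseteq> {i, n + 1}" "i \<in> \<sigma> x"
      using sub[of x] by blast
    then show ?thesis
    proof cases
      case 1
      then have "\<sigma> x = {} \<or> \<sigma> x = {n + 1}" by blast
      then show ?thesis by (auto simp: S_code_def)
    next
      case 2
      then have "\<sigma> x = {i} \<or> \<sigma> x = {i, n + 1}" by blast
      then show ?thesis using 2(1) by (auto simp: S_code_def)
    qed
  qed
  moreover have "\<exists>x\<in>?E. \<tau> = \<sigma> x" if "\<tau> \<in> S_code n" for \<tau>
  proof -
    have eqI: "\<tau> = \<sigma> x" if "\<tau> \<subseteq> insert (n + 1) {1..n}" "\<And>i. i \<in> {1..n} \<Longrightarrow> i \<in> \<tau> \<longleftrightarrow> i \<in> \<sigma> x"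
        "n + 1 \<in> \<tau> \<longleftrightarrow> n + 1 \<in> \<sigma> x" for x
      using that sub[of x] by blast
    \<comment> \<open>Witnesses come from the axes (\<open>e i r\<close>, nonzero only at coordinate
      \<open>i - 1\<close>, since petals are counted from 1) and from the diagonal
      (\<open>f r\<close>).\<close>
    define e :: "nat \<Rightarrow> real \<Rightarrow> nat \<Rightarrow> real" where "e i r = (\<lambda>j. if j + 1 = i then r else 0)" for i r
    define f :: "real \<Rightarrow> nat \<Rightarrow> real" where "f r = (\<lambda>j. if j < n then r else 0)" for r
    have eE: "e i r \<in> ?E" if "i \<in> {1..n}" for i r
      using that by (auto simp: e_def topspace_Euclidean_space)
    have fE: "f r \<in> ?E" for r by (auto simp: f_def topspace_Euclidean_space)
    have e1: "n + 1 \<in> \<sigma> (e i r) \<longleftrightarrow> real n < r" if i: "i \<in> {1..n}" for i r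
    proof -
      have "(\<Sum>j<n. e i r j) = (\<Sum>j<n. if j = i - 1 then r else 0)"
        using i by (intro sum.cong) (auto simp: e_def)
      also have "\<dots> = r"
      proof -
        have "i - 1 < n" using i by auto
        then show ?thesis by simp
      qed
      finally show ?thesis using mem'[OF eE[OF i]] by simp
    qed
    have e2: "k \<in> \<sigma> (e i r) \<longleftrightarrow> k = i" if "i \<in> {1..n}" "k \<in> {1..n}" "1 \<le> r" "r < real n + 2" for i k r
      unfolding mem[OF eE[OF that(1)] that(2)]
    proof
      assume *: "\<forall>j<n. -1 < e i r j \<and> e i r j < (if j + 1 = k then real n + 2 else 1)"
      show "k = i"
      proof (rule ccontr)
        assume "k \<noteq> i"
        moreover have "i - 1 < n" "i - 1 + 1 = i" using that(1) by auto
        ultimately show False using *[rule_format, of "i - 1"] that(3) by (simp add: e_def)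
      qed
    qed (use that in \<open>auto simp: e_def\<close>)
    have f1: "n + 1 \<in> \<sigma> (f r) \<longleftrightarrow> real n < real n * r" for r
      using mem'[OF fE] by (simp add: f_def)
    \<comment> \<open>For \<open>n = 1\<close> the only petal contains \<open>f r\<close> for
      \<open>1 \<le> r < n + 2\<close>, hence the excluded range.\<close>
    have f2: "k \<in> \<sigma> (f r) \<longleftrightarrow> -1 < r \<and> r < 1" if "k \<in> {1..n}" "r < 1 \<or> real n + 2 \<le> r" for k r
      unfolding mem[OF fE that(1)]
    proof
      assume "\<forall>j<n. -1 < f r j \<and> f r j < (if j + 1 = k then real n + 2 else 1)"
      moreover have "k - 1 < n" using that(1) by auto
      ultimately show "-1 < r \<and> r < 1"
        using that by (force simp: f_def)
    qed (auto simp: f_def)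
    note ef = e1 f1 e1[unfolded Suc_eq_plus1[symmetric]] f1[unfolded Suc_eq_plus1[symmetric]] e2 f2
    consider "\<tau> = {1..n}" | i where "\<tau> = {i}" "i \<in> {1..n}" | "\<tau> = {n + 1}"
      | i where "\<tau> = {i, n + 1}" "i \<in> {1..n}" | "\<tau> = {}"
      using \<open>\<tau> \<in> S_code n\<close> unfolding S_code_def by force
    then show ?thesis
    proof cases
      case 1
      then have "\<tau> = \<sigma> (f 0)" by (intro eqI) (auto simp: ef)
      then show ?thesis using fE by blast
    next
      case (2 i)
      \<comment> \<open>The strict bound 1 removes this point from the other petals, and its
        coordinate sum 1 does not exceed \<open>n\<close>.\<close>
      then have "\<tau> = \<sigma> (e i 1)" using n by (intro eqI) (auto simp: ef)
      then show ?thesis using eE[OF 2(2)] by blast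
    next
      case 3
      have "real n < real n * (real n + 2)" using n mult_strict_left_mono[of 1 "real n + 2" "real n"] by simp
      then have "\<tau> = \<sigma> (f (real n + 2))" using 3 by (intro eqI) (auto simp: ef)
      then show ?thesis using fE by blast
    next
      case (4 i)
      \<comment> \<open>The value lies strictly between the threshold \<open>n\<close> of the
        half-space and the bound \<open>n + 2\<close> of the petal.\<close>
      then have "\<tau> = \<sigma> (e i (real n + 1))" by (intro eqI) (auto simp: ef)
      then show ?thesis using eE[OF 4(2)] by blast
    next
      case 5
      \<comment> \<open>The value -1 violates the strict lower bound of every petal.\<close>
      then have "\<tau> = \<sigma> (f (- 1))" by (intro eqI) (auto simp: ef)
      then show ?thesis using fE by blast
    qed
  qed
  ultimately show ?thesis
    unfolding code_of_eq_image \<sigma>_def[symmetric] by blast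
qed

theorem theorem5p4:
  fixes n :: nat
  assumes "n \<ge> 1"
  shows "odim (n + 1) (S_code n) = enat n"
proof -
  have "open_convex_realizable n (n + 1) (S_code n)"
    unfolding open_convex_realizable_def
    using openin_S_realization fun_convex_S_realization S_code_eq_code_of[OF assms] by blast
  then have "(LEAST d. open_convex_realizable d (n + 1) (S_code n)) = n"
    using S_code_lower_bound[OF assms] by (rule Least_equality)
  then show ?thesis
    unfolding odim_def using \<open>open_convex_realizable n (n + 1) (S_code n)\<close> by auto
qed

end
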